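(* Let $d\ge 3$ and let $P$ be a simplicial $d$-polytope whose graph $G(P)$ has minimum degree $\delta$. Then $G(P)$ is $\min\{\delta,4d-6\}$-edge-connected.
   Context: A (convex) polytope is the convex hull of a finite set of points in a Euclidean space; a $d$-polytope is a polytope of dimension $d$. A facet of a $d$-polytope is a face of dimension $d-1$. A polytope is simplicial if all its facets are (combinatorially isomorphic to) simplices. The graph $G(P)$ of a polytope $P$ is the finite simple graph whose vertices and edges are the vertices ($0$-dimensional faces) and edges ($1$-dimensional faces) of $P$. Graph properties of a polytope (minimum degree, edge connectivity) mean those of its graph. A set $Z$ of edges separates two distinct vertices $x,y$ of a graph if every path from $x$ to $y$ contains an element of $Z$. A graph is $r$-edge-connected, for $r\ge 0$, if no two distinct vertices are separated by fewer than $r$ edges. *)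

theory Defs
  imports "HOL-Analysis.Analysis"
begin

record 'v graph =
  gverts :: "'v set"
  gedges :: "'v set set"

definition finite_simple_graph :: "'v graph \<Rightarrow> bool" where
  "finite_simple_graph G \<longleftrightarrow>
     finite (gverts G) \<and> (\<forall>e\<in>gedges G. e \<subseteq> gverts G \<and> card e = 2)"

definition vdegree :: "'v graph \<Rightarrow> 'v \<Rightarrow> nat" where
  "vdegree G v = card {e \<in> gedges G. v \<in> e}"

definition min_degree :: "'v graph \<Rightarrow> nat" where
  "min_degree G = Min (vdegree G ` gverts G)"

definition path_edges :: "'v list \<Rightarrow> 'v set set" where
  "path_edges p = {{p ! i, p ! Suc i} | i. Suc i < length p}"

definition is_path :: "'v graph \<Rightarrow> 'v \<Rightarrow> 'v list \<Rightarrow> 'v \<Rightarrow> bool" where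
  "is_path G x p y \<longleftrightarrow>
     p \<noteq> [] \<and> hd p = x \<and> last p = y \<and> distinct p \<and>
     set p \<subseteq> gverts G \<and> path_edges p \<subseteq> gedges G"

definition edge_separates :: "'v graph \<Rightarrow> 'v set set \<Rightarrow> 'v \<Rightarrow> 'v \<Rightarrow> bool" where
  "edge_separates G Z x y \<longleftrightarrow> (\<forall>p. is_path G x p y \<longrightarrow> path_edges p \<inter> Z \<noteq> {})"

definition edge_connected :: "nat \<Rightarrow> 'v graph \<Rightarrow> bool" where
  "edge_connected r G \<longleftrightarrow>
     (\<forall>x\<in>gverts G. \<forall>y\<in>gverts G. x \<noteq> y \<longrightarrow>
        \<not> (\<exists>Z. Z \<subseteq> gedges G \<and> finite Z \<and> card Z < r \<and> edge_separates G Z x y))"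

text \<open>A 1-dimensional face of a polytope is a segment; it is represented in the
  graph by the pair of its end points.\<close>

definition polytope_graph :: "'a::euclidean_space set \<Rightarrow> 'a graph" where
  "polytope_graph P =
     \<lparr>gverts = {v. {v} face_of P},
      gedges = {{x, y} | x y. closed_segment x y edge_of P}\<rparr>"

lemma finite_simple_polytope_graph:
  assumes "polytope P"
  shows "finite_simple_graph (polytope_graph P)"
proof -
  have fin: "finite {v. {v} face_of P}"
    using finite_polyhedron_extreme_points[OF polytope_imp_polyhedron[OF assms]]
    by (simp only: face_of_singleton)
  have ends: "x \<noteq> y \<and> {x} face_of P \<and> {y} face_of P"
    if e: "closed_segment x y edge_of P" for x y
  proof -
    have f: "closed_segment x y face_of P" and d: "aff_dim (closed_segment x y) = 1"
      using e unfolding edge_of_def by blast+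
    have "x \<noteq> y"
      using d by (metis aff_dim_sing closed_segment_idem zero_neq_one)
    moreover have "{x} face_of closed_segment x y" "{y} face_of closed_segment x y"
      unfolding face_of_singleton extreme_point_of_segment by blast+
    ultimately show ?thesis
      using face_of_trans[OF _ f] by blast
  qed
  have "e \<subseteq> {v. {v} face_of P} \<and> card e = 2"
    if e: "e \<in> {{x, y} | x y. closed_segment x y edge_of P}" for e
  proof -
    obtain x y where "e = {x, y}" "closed_segment x y edge_of P"
      using e by blast
    then show ?thesis
      using ends[of x y] by simp
  qed
  with fin show ?thesis
    unfolding finite_simple_graph_def polytope_graph_def by simp
qed

text \<open>Combinatorial isomorphism is isomorphism of the face lattices, which contain
  the empty face and the polytope itself.\<close>

definition combinatorially_isomorphic ::
    "'a::euclidean_space set \<Rightarrow> 'b::euclidean_space set \<Rightarrow> bool" where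
  "combinatorially_isomorphic P Q \<longleftrightarrow>
     (\<exists>f. bij_betw f {F. F face_of P} {G. G face_of Q} \<and>
          (\<forall>F F'. F face_of P \<longrightarrow> F' face_of P \<longrightarrow> (F \<subseteq> F' \<longleftrightarrow> f F \<subseteq> f F')))"

text \<open>Taking the simplex in the same space is no restriction, since it has the
  dimension of the facet.\<close>

definition simplicial_polytope :: "'a::euclidean_space set \<Rightarrow> bool" where
  "simplicial_polytope P \<longleftrightarrow>
     polytope P \<and>
     (\<forall>F. F facet_of P \<longrightarrow>
        (\<exists>n (S :: 'a set). n simplex S \<and> combinatorially_isomorphic F S))"

end

theory Submission
  imports Defs
begin

text \<open>
  Let \<open>X\<close> be one side of an edge cut with fewer than \<open>\<delta>\<close> edges. A counting argument gives
  vertices on both sides that are incident with no cut edge, so a vertex cover of the cut edges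
  separates the graph, and by Balinski's theorem it has at least \<open>d\<close> elements. By Koenig's
  theorem there are \<open>d\<close> pairwise disjoint cut edges. Since \<open>P\<close> is simplicial, the ends of an edge
  have at least \<open>d - 1\<close> common neighbours, and each such triangle contains a second cut edge.
  Every cut edge outside the matching is counted for at most two matching edges, so the cut has at
  least \<open>d + d (d - 1) / 2\<close> edges, and this is at least \<open>4 d - 6\<close>.
\<close>

section \<open>Matchings and edge cuts\<close>

text \<open>Position in the pair tells the two sides of the bipartite graph apart, so they may share
  elements. Finiteness is demanded because \<open>card\<close> of an infinite set is 0.\<close>

definition covers :: "('a \<times> 'b) set \<Rightarrow> 'a set \<Rightarrow> 'b set \<Rightarrow> bool" where
  "covers E S T \<longleftrightarrow> finite S \<and> finite T \<and> (\<forall>u v. (u, v) \<in> E \<longrightarrow> u \<in> S \<or> v \<in> T)"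

lemma covers_converse: "covers (E\<inverse>) T S \<longleftrightarrow> covers E S T"
  unfolding covers_def by auto

lemma inj_on_fst_if_cover_critical:
  assumes large: "\<And>S T. covers E S T \<Longrightarrow> k \<le> card S + card T"
    and crit: "\<And>e. e \<in> E \<Longrightarrow> \<exists>S T. covers (E - {e}) S T \<and> card S + card T < k"
  shows "inj_on fst E"
proof (rule inj_onI, rule ccontr)
  \<comment> \<open>Lovasz: if two edges share an end, the covers left by deleting either one uncross to two
    covers whose total size is too small.\<close>
  fix e1 e2 assume e: "e1 \<in> E" "e2 \<in> E" "fst e1 = fst e2" "e1 \<noteq> e2"
  obtain a b1 b2 where e12: "e1 = (a, b1)" "e2 = (a, b2)"
    using e(3) by (metis prod.collapse)
  have "b1 \<noteq> b2" using e(4) e12 by simp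
  obtain S1 T1 where 1: "covers (E - {e1}) S1 T1" "card S1 + card T1 < k"
    using crit[OF e(1)] by blast
  obtain S2 T2 where 2: "covers (E - {e2}) S2 T2" "card S2 + card T2 < k"
    using crit[OF e(2)] by blast
  have fin: "finite S1" "finite T1" "finite S2" "finite T2"
    using 1 2 unfolding covers_def by auto
  have c1: "u \<in> S1 \<or> v \<in> T1" if "(u, v) \<in> E" "u \<noteq> a \<or> v \<noteq> b1" for u v
    using 1 that unfolding covers_def e12 by blast
  have c2: "u \<in> S2 \<or> v \<in> T2" if "(u, v) \<in> E" "u \<noteq> a \<or> v \<noteq> b2" for u v
    using 2 that unfolding covers_def e12 by blast
  \<comment> \<open>Otherwise \<open>(S1, T1)\<close> would also cover \<open>e1\<close>, hence all
    of \<open>E\<close>, with fewer than \<open>k\<close> vertices.\<close>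
  have a1: "a \<notin> S1"
  proof
    assume "a \<in> S1"
    then have "covers E S1 T1"
      unfolding covers_def using fin c1 by metis
    then show False using large 1(2) by fastforce
  qed
  have a2: "a \<notin> S2"
  proof
    assume "a \<in> S2"
    then have "covers E S2 T2"
      unfolding covers_def using fin c2 by metis
    then show False using large 2(2) by fastforce
  qed
  have b: "b1 \<in> T2" "b2 \<in> T1"
    using c1[of a b2] c2[of a b1] a1 a2 e e12 \<open>b1 \<noteq> b2\<close> by auto
  have "covers E (S1 \<inter> S2) (T1 \<union> T2)"
    unfolding covers_def using fin b c1 c2 by (metis Int_iff Un_iff finite_Int finite_UnI)
  then have "k \<le> card (S1 \<inter> S2) + card (T1 \<union> T2)" by (rule large)
  \<comment> \<open>Putting \<open>a\<close> back pays for \<open>e1\<close> and \<open>e2\<close>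
    together. The two new covers have total size at least \<open>2 * k\<close>, but by
    inclusion-exclusion at most \<open>2 * (k - 1) + 1\<close>.\<close>
  moreover have "covers E (insert a (S1 \<union> S2)) (T1 \<inter> T2)"
    unfolding covers_def using fin c1 c2
    by (metis Int_iff Un_iff finite_Int finite_UnI finite_insert insert_iff)
  then have "k \<le> card (insert a (S1 \<union> S2)) + card (T1 \<inter> T2)" by (rule large)
  moreover have "card (insert a (S1 \<union> S2)) \<le> card (S1 \<union> S2) + 1"
    using fin by (simp add: card_insert_if)
  moreover have "card S1 + card S2 = card (S1 \<union> S2) + card (S1 \<inter> S2)"
    "card T1 + card T2 = card (T1 \<union> T2) + card (T1 \<inter> T2)"
    using card_Un_Int fin by blast+
  ultimately show False using 1(2) 2(2) by linarith
qed

text \<open>The hard half of Koenig's theorem. Edges are deleted as long as all covers keep size at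
  least \<open>k\<close>. The edge set left at the end is critical, hence itself a matching, and its
  left ends form a cover with as many elements as there are edges.\<close>

lemma matching_of_large_covers:
  fixes E :: "('a \<times> 'b) set"
  assumes "finite E" and "\<And>S T. covers E S T \<Longrightarrow> k \<le> card S + card T"
  shows "\<exists>M\<subseteq>E. inj_on fst M \<and> inj_on snd M \<and> card M = k"
  using assms
proof (induction E rule: finite_psubset_induct)
  case (psubset E)
  show ?case
  proof (cases "\<exists>e\<in>E. \<forall>S T. covers (E - {e}) S T \<longrightarrow> k \<le> card S + card T")
    case True
    then obtain e where e: "e \<in> E" and "\<And>S T. covers (E - {e}) S T \<Longrightarrow> k \<le> card S + card T"
      by blast
    then have "\<exists>M\<subseteq>E - {e}. inj_on fst M \<and> inj_on snd M \<and> card M = k"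
      by (intro psubset.IH) auto
    then show ?thesis by blast
  next
    case False
    then have crit: "\<exists>S T. covers (E - {e}) S T \<and> card S + card T < k" if "e \<in> E" for e
      using that by (meson not_le)
    have fst: "inj_on fst E"
      by (rule inj_on_fst_if_cover_critical[OF psubset.prems crit])
    \<comment> \<open>Criticality controls left ends only; applied to the converse relation it
      controls the right ends.\<close>
    have inj: "inj_on fst (E\<inverse>)"
    proof (rule inj_on_fst_if_cover_critical)
      show "k \<le> card T + card S" if "covers (E\<inverse>) T S" for S T
        using psubset.prems that by (simp add: covers_converse add.commute)
      fix e assume e: "e \<in> E\<inverse>"
      then have "prod.swap e \<in> E" by auto
      then obtain S T where "covers (E - {prod.swap e}) S T" "card S + card T < k"
        using crit by blast
      moreover have "E\<inverse> - {e} = (E - {prod.swap e})\<inverse>"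
        by (cases e) auto
      ultimately have "covers (E\<inverse> - {e}) T S \<and> card T + card S < k"
        by (simp add: covers_converse add.commute)
      then show "\<exists>T S. covers (E\<inverse> - {e}) T S \<and> card T + card S < k" by blast
    qed
    have snd: "inj_on snd E"
    proof (rule inj_onI)
      fix e f assume "e \<in> E" "f \<in> E" "snd e = snd f"
      then show "e = f"
        using inj_onD[OF inj, of "prod.swap e" "prod.swap f"] by (cases e, cases f) auto
    qed
    have "covers E (fst ` E) {}"
      unfolding covers_def using psubset.hyps by force
    then have "k \<le> card (fst ` E) + card ({} :: 'b set)" by (rule psubset.prems)
    then have "k \<le> card E"
      using card_image[OF fst] by simp
    then obtain M where "M \<subseteq> E" "card M = k"
      by (metis obtain_subset_with_card_n)
    then show ?thesis
      using inj_on_subset[OF fst] inj_on_subset[OF snd] by (intro exI[of _ M]) simp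
  qed
qed

lemma sum_card_fibres_le:
  assumes "finite D" "finite M" "inj_on g M"
  shows "(\<Sum>e\<in>M. card {f \<in> D. g f = g e}) \<le> card D"
proof -
  have "(\<Sum>e\<in>M. card {f \<in> D. g f = g e}) = card (\<Union>e\<in>M. {f \<in> D. g f = g e})"
    using assms by (intro card_UN_disjoint[symmetric]) (auto dest: inj_onD)
  also have "\<dots> \<le> card D"
    using assms by (intro card_mono) auto
  finally show ?thesis .
qed

text \<open>An edge of \<open>C - M\<close> shares its left end with at most one edge of
  \<open>M\<close>, and likewise its right end, so it is counted at most twice. Two edges of
  \<open>M\<close> share no end and are never counted for each other.\<close>

lemma matching_double_count:
  fixes C M :: "('a \<times> 'b) set"
  assumes "finite C" "M \<subseteq> C" "inj_on fst M" "inj_on snd M"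
    and k: "\<And>e. e \<in> M \<Longrightarrow> k \<le> card {f \<in> C. f \<noteq> e \<and> (fst f = fst e \<or> snd f = snd e)}"
  shows "card M * k \<le> 2 * (card C - card M)"
proof -
  have fin: "finite M" "finite (C - M)"
    using assms finite_subset by auto
  have "card M * k = (\<Sum>e\<in>M. k)" by simp
  also have "\<dots> \<le> (\<Sum>e\<in>M. card {f \<in> C - M. fst f = fst e} + card {f \<in> C - M. snd f = snd e})"
  proof (rule sum_mono)
    fix e assume e: "e \<in> M"
    have "{f \<in> C. f \<noteq> e \<and> (fst f = fst e \<or> snd f = snd e)}
        \<subseteq> {f \<in> C - M. fst f = fst e} \<union> {f \<in> C - M. snd f = snd e}"
      using assms(3,4) e by (auto dest: inj_onD)
    then have "card {f \<in> C. f \<noteq> e \<and> (fst f = fst e \<or> snd f = snd e)}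
        \<le> card ({f \<in> C - M. fst f = fst e} \<union> {f \<in> C - M. snd f = snd e})"
      using fin by (intro card_mono) auto
    also have "\<dots> \<le> card {f \<in> C - M. fst f = fst e} + card {f \<in> C - M. snd f = snd e}"
      by (rule card_Un_le)
    finally show "k \<le> \<dots>" using k[OF e] by linarith
  qed
  also have "\<dots> \<le> card (C - M) + card (C - M)"
    unfolding sum.distrib using assms fin by (intro add_mono sum_card_fibres_le)
  also have "\<dots> = 2 * (card C - card M)"
    using assms fin by (simp add: card_Diff_subset)
  finally show ?thesis .
qed

section \<open>Paths and edge cuts\<close>

lemma path_edges_append_single:
  assumes "p \<noteq> []"
  shows "path_edges (p @ [v]) = insert {last p, v} (path_edges p)"
proof
  show "path_edges (p @ [v]) \<subseteq> insert {last p, v} (path_edges p)"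
  proof
    fix e assume "e \<in> path_edges (p @ [v])"
    then obtain i where i: "Suc i < Suc (length p)" "e = {(p @ [v]) ! i, (p @ [v]) ! Suc i}"
      unfolding path_edges_def by auto
    show "e \<in> insert {last p, v} (path_edges p)"
    proof (cases "Suc i < length p")
      case True
      then have "e = {p ! i, p ! Suc i}" using i by (simp add: nth_append)
      then show ?thesis using True unfolding path_edges_def by blast
    next
      case False
      then have "i = length p - 1" "Suc i = length p" using i by auto
      then have "e = {last p, v}" using i assms by (simp add: nth_append last_conv_nth)
      then show ?thesis by blast
    qed
  qed
  have "{last p, v} \<in> path_edges (p @ [v])"
    unfolding path_edges_def using assms
    by (intro CollectI exI[of _ "length p - 1"]) (simp add: nth_append last_conv_nth)
  moreover have "path_edges p \<subseteq> path_edges (p @ [v])"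
    unfolding path_edges_def by (fastforce simp: nth_append)
  ultimately show "insert {last p, v} (path_edges p) \<subseteq> path_edges (p @ [v])" by blast
qed

lemma path_edges_take: "path_edges (take n p) \<subseteq> path_edges p"
proof
  fix e assume "e \<in> path_edges (take n p)"
  then obtain i where "Suc i < length (take n p)" "e = {take n p ! i, take n p ! Suc i}"
    unfolding path_edges_def by blast
  then have "Suc i < length p" "e = {p ! i, p ! Suc i}" by auto
  then show "e \<in> path_edges p" unfolding path_edges_def by blast
qed

text \<open>A path must have distinct vertices, so a walk is not enough: when the next vertex
  already occurs on the path, the path is cut back to that occurrence.\<close>

lemma rtrancl_imp_path:
  assumes "finite_simple_graph G" "x \<in> gverts G"
    and "(x, y) \<in> {(u, v). {u, v} \<in> gedges G - Z}\<^sup>*"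
  shows "\<exists>p. is_path G x p y \<and> path_edges p \<inter> Z = {}"
  using assms(3)
proof (induction rule: rtrancl_induct)
  case base
  have "is_path G x [x] x \<and> path_edges [x] \<inter> Z = {}"
    using assms by (auto simp: is_path_def path_edges_def)
  then show ?case by blast
next
  case (step u v)
  then obtain p where p: "is_path G x p u" "path_edges p \<inter> Z = {}" and uv: "{u, v} \<in> gedges G - Z"
    by auto
  show ?case
  proof (cases "v \<in> set p")
    case True
    then obtain i where i: "i < length p" "p ! i = v"
      by (metis in_set_conv_nth)
    then have "last (take (Suc i) p) = v"
      by (simp add: take_Suc_conv_app_nth)
    moreover have "hd (take (Suc i) p) = hd p"
      by (cases p) auto
    ultimately have "is_path G x (take (Suc i) p) v"
      using p(1) path_edges_take[of "Suc i" p] set_take_subset[of "Suc i" p]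
      unfolding is_path_def by auto
    then show ?thesis
      using p(2) path_edges_take[of "Suc i" p] by blast
  next
    case False
    have "v \<in> gverts G"
      using uv assms(1) unfolding finite_simple_graph_def by blast
    then have "is_path G x (p @ [v]) v" "path_edges (p @ [v]) \<inter> Z = {}"
      using False p uv unfolding is_path_def by (auto simp: path_edges_append_single)
    then show ?thesis by blast
  qed
qed

text \<open>Each cut edge appears exactly once, oriented out of \<open>X\<close>, so the cut becomes
  a bipartite graph to which \<open>covers\<close> applies.\<close>

definition cut_pairs :: "'v graph \<Rightarrow> 'v set \<Rightarrow> ('v \<times> 'v) set" where
  "cut_pairs G X = {(u, v). u \<in> X \<and> v \<in> gverts G - X \<and> {u, v} \<in> gedges G}"

lemma cut_pairs_complement:
  assumes "X \<subseteq> gverts G"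
  shows "cut_pairs G (gverts G - X) = (cut_pairs G X)\<inverse>"
  using assms unfolding cut_pairs_def by (auto simp: insert_commute)

lemma finite_cut_pairs:
  assumes "finite_simple_graph G" "X \<subseteq> gverts G"
  shows "finite (cut_pairs G X)"
proof (rule finite_subset)
  show "cut_pairs G X \<subseteq> gverts G \<times> gverts G"
    using assms(2) unfolding cut_pairs_def by blast
qed (use assms in \<open>simp add: finite_simple_graph_def\<close>)

text \<open>Every neighbour of \<open>x\<close> pays with its own cut edge: a neighbour in
  \<open>X\<close> with a chosen cut edge at itself, a neighbour outside with its edge to
  \<open>x\<close>. Read contrapositively, a cut smaller than the minimum degree misses some vertex
  of \<open>X\<close>.\<close>

lemma vdegree_le_card_cut_pairs:
  assumes G: "finite_simple_graph G" and X: "X \<subseteq> gverts G" "x \<in> X"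
    and cut: "\<And>u. u \<in> X \<Longrightarrow> u \<in> Domain (cut_pairs G X)"
  shows "vdegree G x \<le> card (cut_pairs G X)"
proof -
  define N where "N = {w. {x, w} \<in> gedges G}"
  have E: "e \<subseteq> gverts G" "card e = 2" if "e \<in> gedges G" for e
    using G that unfolding finite_simple_graph_def by blast+
  have "N \<subseteq> gverts G"
    using E(1) unfolding N_def by blast
  then have finN: "finite N"
    using G finite_subset unfolding finite_simple_graph_def by blast
  have "x \<notin> N"
    using E(2)[of "{x}"] unfolding N_def by auto
  obtain h where h: "\<And>u. u \<in> X \<Longrightarrow> (u, h u) \<in> cut_pairs G X"
    using cut unfolding Domain_iff by metis
  have "{e \<in> gedges G. x \<in> e} \<subseteq> (\<lambda>w. {x, w}) ` N"
  proof
    fix e assume e: "e \<in> {e \<in> gedges G. x \<in> e}"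
    then obtain a b where "e = {a, b}"
      using E(2) card_2_iff by (metis (no_types, lifting) mem_Collect_eq)
    then show "e \<in> (\<lambda>w. {x, w}) ` N"
      using e unfolding N_def by (auto simp: insert_commute)
  qed
  then have "vdegree G x \<le> card N"
    unfolding vdegree_def using finN by (meson surj_card_le)
  also have "card N \<le> card (cut_pairs G X)"
  proof (rule card_inj_on_le)
    let ?f = "\<lambda>w. if w \<in> X then (w, h w) else (x, w)"
    show "inj_on ?f N"
      using \<open>x \<notin> N\<close> by (auto simp: inj_on_def split: if_splits)
    show "?f ` N \<subseteq> cut_pairs G X"
      using h X \<open>N \<subseteq> gverts G\<close> unfolding N_def by (auto simp: cut_pairs_def)
    show "finite (cut_pairs G X)"
      using finite_cut_pairs G X(1) by blast
  qed
  finally show ?thesis .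
qed

section \<open>Connectivity of polytope graphs\<close>

lemma polyhedron_in_rel_interior_of_face:
  fixes P :: "'a::euclidean_space set"
  assumes "polyhedron P" "q \<in> P"
  shows "\<exists>G. G face_of P \<and> q \<in> rel_interior G"
  using assms
proof (induction "nat (aff_dim P)" arbitrary: P rule: less_induct)
  case less
  show ?case
  proof (cases "q \<in> rel_interior P")
    case True
    then show ?thesis
      using face_of_refl less.prems polyhedron_imp_convex by blast
  next
    case False
    then have "q \<in> rel_frontier P"
      using less.prems closure_subset by (auto simp: rel_frontier_def)
    then obtain F where F: "F face_of P" "F \<noteq> P" "q \<in> F"
      using rel_frontier_of_polyhedron_alt[OF less.prems(1)] by blast
    have "aff_dim F < aff_dim P"
      using F face_of_aff_dim_lt less.prems polyhedron_imp_convex by blast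
    moreover have "0 \<le> aff_dim F"
      using F(3) by (metis aff_dim_sing aff_dim_subset empty_subsetI insert_subset)
    ultimately have "nat (aff_dim F) < nat (aff_dim P)" by linarith
    moreover have "polyhedron F"
      using F face_of_polyhedron_polyhedron less.prems by blast
    ultimately show ?thesis
      using less.hyps F face_of_trans by blast
  qed
qed

text \<open>Since \<open>q\<close> is both extreme in the section and in its relative interior, the
  section is the single point \<open>q\<close>. The same then holds for the affine hull of
  \<open>G\<close>, and a hyperplane meeting an affine set lowers its dimension by at most
  one.\<close>

lemma extreme_point_of_hyperplane_section:
  fixes G :: "'a::euclidean_space set"
  assumes "convex G" "q \<in> rel_interior G" "q extreme_point_of (G \<inter> {x. c \<bullet> x = \<beta>})"
  shows "aff_dim G \<le> 1"
proof -
  let ?H = "{x. c \<bullet> x = \<beta>}"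
  have q: "q \<in> rel_interior G \<inter> ?H"
    using assms by (auto simp: extreme_point_of_def)
  have ri: "rel_interior (G \<inter> ?H) = rel_interior G \<inter> ?H"
    using q assms(1) by (intro convex_affine_rel_interior_Int affine_hyperplane) auto
  have "G \<inter> ?H = {q}"
    using extreme_point_not_in_REL_INTERIOR[OF assms(3)] q ri by blast
  obtain e where e: "e > 0" "cball q e \<inter> affine hull G \<subseteq> G"
    using assms(2) by (auto simp: mem_rel_interior_cball)
  have qa: "q \<in> affine hull G"
    using assms(2) rel_interior_subset by (metis hull_inc subsetD)
  have "affine hull G \<inter> ?H \<subseteq> {q}"
  proof
    fix z assume z: "z \<in> affine hull G \<inter> ?H"
    show "z \<in> {q}"
    proof (rule ccontr)
      assume "z \<notin> {q}"
      then have n: "norm (z - q) > 0" by simp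
      \<comment> \<open>The point at distance \<open>e\<close> from \<open>q\<close> towards
        \<open>z\<close> is still in \<open>G\<close> and in the hyperplane, yet differs from
        \<open>q\<close>.\<close>
      define w where "w = q + (e / norm (z - q)) *\<^sub>R (z - q)"
      have w2: "w = (1 - e / norm (z - q)) *\<^sub>R q + (e / norm (z - q)) *\<^sub>R z"
        by (simp add: w_def algebra_simps)
      have "w \<in> affine hull G"
        unfolding w2 using z qa by (intro mem_affine) auto
      moreover have "w \<in> ?H"
        unfolding w2 using z q by (intro mem_affine[OF affine_hyperplane]) auto
      moreover have "w \<in> cball q e"
        using n e by (simp add: w_def dist_norm)
      ultimately have "w \<in> G \<inter> ?H" using e by blast
      then have "w = q" using \<open>G \<inter> ?H = {q}\<close> by blast
      then show False using n e by (simp add: w_def)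
    qed
  qed
  then have "aff_dim (affine hull G \<inter> ?H) \<le> 0"
    by (metis aff_dim_sing aff_dim_subset)
  moreover have "affine hull G \<inter> ?H \<noteq> {}"
    using q qa by blast
  ultimately show ?thesis
    using aff_dim_affine_Int_hyperplane[OF affine_affine_hull, of G c \<beta>]
    by (auto simp: aff_dim_affine_hull split: if_splits)
qed

text \<open>A maximiser of \<open>a\<close> on a hyperplane section of \<open>P\<close> that cuts off only the vertex \<open>v\<close>
  lies on an edge through \<open>v\<close>.\<close>
lemma polytope_increasing_edge:
  fixes P :: "'a::euclidean_space set"
  assumes P: "polytope P" and v: "{v} face_of P" and p: "p \<in> P" "a \<bullet> v < a \<bullet> p"
  shows "\<exists>w. closed_segment v w edge_of P \<and> a \<bullet> v < a \<bullet> w"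
proof -
  have poly: "polyhedron P" and conv: "convex P" and comp: "compact P"
    using P polytope_imp_polyhedron polytope_imp_convex polytope_imp_compact by blast+
  have "{v} exposed_face_of P"
    using exposed_face_of_polyhedron poly v by blast
  then obtain c b where sup: "P \<subseteq> {x. c \<bullet> x \<le> b}" and vb: "{v} = P \<inter> {x. c \<bullet> x = b}"
    unfolding exposed_face_of_def by blast
  have lt: "c \<bullet> x < b" if "x \<in> P" "x \<noteq> v" for x
  proof -
    have "c \<bullet> x \<noteq> b" using that vb by blast
    moreover have "c \<bullet> x \<le> b" using that sup by blast
    ultimately show ?thesis by simp
  qed
  have cv: "c \<bullet> v = b" using vb by blast
  \<comment> \<open>With \<open>p\<close> included, a level \<open>\<beta>\<close> between
    \<open>m\<close> and \<open>b\<close> separates \<open>v\<close> from \<open>p\<close> as well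
    as from all other vertices.\<close>
  define E where "E = insert p ({x. x extreme_point_of P} - {v})"
  have finE: "finite E"
    unfolding E_def using finite_polyhedron_extreme_points[OF poly] by simp
  have "p \<noteq> v" using p by auto
  have E_lt: "c \<bullet> x < b" if "x \<in> E" for x
    using that lt p(1) \<open>p \<noteq> v\<close> unfolding E_def by (auto simp: extreme_point_of_def)
  define m where "m = Max ((\<bullet>) c ` E)"
  have "m < b"
    unfolding m_def using finE E_lt by (subst Max_less_iff) (auto simp: E_def)
  then obtain \<beta> where \<beta>: "m < \<beta>" "\<beta> < b"
    using dense by blast
  have E_beta: "c \<bullet> x < \<beta>" if "x \<in> E" for x
    using that finE \<beta>(1) unfolding m_def by (meson Max_ge finite_imageI imageI le_less_trans)
  let ?H = "{x. c \<bullet> x = \<beta>}"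
  \<comment> \<open>The parameter at which the segment from \<open>v\<close> to \<open>p\<close>
    crosses the hyperplane.\<close>
  define t where "t = (b - \<beta>) / (b - c \<bullet> p)"
  have cp: "c \<bullet> p < \<beta>" using E_beta by (simp add: E_def)
  have t: "0 < t" "t < 1" "t * (b - c \<bullet> p) = b - \<beta>"
    using cp \<beta> by (auto simp: t_def)
  define q0 where "q0 = (1 - t) *\<^sub>R v + t *\<^sub>R p"
  have vP: "v \<in> P" using vb by blast
  have "q0 \<in> P"
    unfolding q0_def using t conv vP p(1) by (intro convexD) auto
  moreover have "c \<bullet> q0 = \<beta>"
    using t(3) cv by (simp add: q0_def inner_simps algebra_simps)
  moreover have aq0: "a \<bullet> v < a \<bullet> q0"
  proof -
    have "a \<bullet> q0 = a \<bullet> v + t * (a \<bullet> p - a \<bullet> v)"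
      by (simp add: q0_def inner_simps algebra_simps)
    then show ?thesis using t(1) p(2) by simp
  qed
  ultimately have q0: "q0 \<in> P \<inter> ?H" by simp
  \<comment> \<open>By Krein-Milman, if no extreme point of the section were higher than
    \<open>v\<close>, neither would be \<open>q0\<close>.\<close>
  have "\<exists>q. q extreme_point_of (P \<inter> ?H) \<and> a \<bullet> v < a \<bullet> q"
  proof (rule ccontr)
    assume "\<not> ?thesis"
    then have "{q. q extreme_point_of (P \<inter> ?H)} \<subseteq> {x. a \<bullet> x \<le> a \<bullet> v}"
      by (auto simp: not_less)
    then have "convex hull {q. q extreme_point_of (P \<inter> ?H)} \<subseteq> {x. a \<bullet> x \<le> a \<bullet> v}"
      by (simp add: hull_minimal convex_halfspace_le)
    moreover have "P \<inter> ?H = convex hull {q. q extreme_point_of (P \<inter> ?H)}"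
      using comp conv closed_hyperplane convex_hyperplane
      by (intro Krein_Milman_Minkowski compact_Int_closed convex_Int) auto
    ultimately show False using q0 aq0 by auto
  qed
  then obtain q where q: "q extreme_point_of (P \<inter> ?H)" "a \<bullet> v < a \<bullet> q" by blast
  then have qP: "q \<in> P" "c \<bullet> q = \<beta>" by (auto simp: extreme_point_of_def)
  obtain G where G: "G face_of P" "q \<in> rel_interior G"
    using polyhedron_in_rel_interior_of_face[OF poly qP(1)] by blast
  have qG: "q \<in> G" using G rel_interior_subset by blast
  have convG: "convex G" using G face_of_imp_convex by blast
  have "q extreme_point_of (G \<inter> ?H)"
    using q(1) qG face_of_imp_subset[OF G(1)] unfolding extreme_point_of_def by blast
  then have dimG: "aff_dim G \<le> 1"
    using extreme_point_of_hyperplane_section convG G(2) by blast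
  have compG: "compact G" using G face_of_imp_compact comp conv by blast
  obtain y z where yz: "G = closed_segment y z"
    using compact_convex_collinear_segment[of G] qG compG convG dimG collinear_aff_dim by blast
  have "y extreme_point_of P" "z extreme_point_of P"
    using extreme_point_of_face[OF G(1)] yz extreme_point_of_segment by blast+
  then have ends: "y = v \<or> c \<bullet> y < \<beta>" "z = v \<or> c \<bullet> z < \<beta>"
    using E_beta unfolding E_def by blast+
  \<comment> \<open>Otherwise both ends, and with them \<open>q\<close>, would lie strictly below
    level \<open>\<beta>\<close>.\<close>
  have "y = v \<or> z = v"
  proof (rule ccontr)
    assume "\<not> ?thesis"
    then have "closed_segment y z \<subseteq> {x. c \<bullet> x < \<beta>}"
      using ends by (intro closed_segment_subset convex_halfspace_lt) auto
    then show False using qG qP(2) yz by auto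
  qed
  then obtain w where w: "G = closed_segment v w"
    using yz closed_segment_commute by metis
  have aw: "a \<bullet> v < a \<bullet> w"
  proof (rule ccontr)
    assume "\<not> ?thesis"
    then have "closed_segment v w \<subseteq> {x. a \<bullet> x \<le> a \<bullet> v}"
      by (intro closed_segment_subset convex_halfspace_le) auto
    then show False using qG q(2) w by auto
  qed
  then have "v \<noteq> w" by auto
  then have "aff_dim G = 1"
    unfolding w by (simp add: segment_convex_hull aff_dim_convex_hull aff_dim_2)
  then have "closed_segment v w edge_of P"
    using G(1) w unfolding edge_of_def by blast
  then show ?thesis using aw by blast
qed

section \<open>Balinski's theorem\<close>

definition edge_rel :: "'a::euclidean_space set \<Rightarrow> 'a set \<Rightarrow> ('a \<times> 'a) set" where
  "edge_rel P W = {(u, v). closed_segment u v edge_of P \<and> u \<notin> W \<and> v \<notin> W}"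

lemma edge_of_imp_vertex:
  assumes "closed_segment u v edge_of P"
  shows "{v} face_of P"
proof -
  have "{v} face_of closed_segment u v"
    unfolding face_of_singleton extreme_point_of_segment by blast
  then show ?thesis
    using assms face_of_trans unfolding edge_of_def by blast
qed

lemma sym_edge_rel: "sym (edge_rel P W)"
  unfolding edge_rel_def sym_def by (auto simp: closed_segment_commute)

lemma rtrancl_edge_rel_sym:
  assumes "(u, v) \<in> (edge_rel P W)\<^sup>*"
  shows "(v, u) \<in> (edge_rel P W)\<^sup>*"
  using assms sym_edge_rel sym_rtrancl symD by metis

lemma rtrancl_edge_rel_vertex:
  assumes "(u, v) \<in> (edge_rel P W)\<^sup>*" "{u} face_of P" "u \<notin> W"
  shows "{v} face_of P" "v \<notin> W"
  using assms by (induction) (auto simp: edge_rel_def intro: edge_of_imp_vertex)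

text \<open>From \<open>u\<close> and from \<open>v\<close> one climbs along edges that increase
  \<open>a\<close> until the face \<open>F\<close> of maximal \<open>a\<close> is reached. All of
  \<open>W\<close> lies at or below level \<open>b\<close>, so neither the climb nor
  \<open>F\<close> meets it. The point \<open>r\<close> makes \<open>F\<close> a proper face, so
  \<open>faces\<close> joins the two arrival points.\<close>

lemma edge_rel_connects_halfspace:
  fixes P :: "'a::euclidean_space set"
  assumes P: "polytope P" and W: "\<And>w. w \<in> W \<Longrightarrow> a \<bullet> w \<le> b"
    and p: "p \<in> P" "b < a \<bullet> p" "r \<in> P" "a \<bullet> r \<le> b"
    and faces: "\<And>F x y. F face_of P \<Longrightarrow> F \<noteq> P \<Longrightarrow> {x} face_of F \<Longrightarrow> {y} face_of F
                  \<Longrightarrow> (x, y) \<in> (edge_rel F {})\<^sup>*"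
    and u: "{u} face_of P" "u \<notin> W" "b \<le> a \<bullet> u"
    and v: "{v} face_of P" "v \<notin> W" "b \<le> a \<bullet> v"
  shows "(u, v) \<in> (edge_rel P W)\<^sup>*"
proof -
  have "compact P" and conv: "convex P"
    using P polytope_imp_compact polytope_imp_convex by blast+
  then obtain z where z: "z \<in> P" "\<And>x. x \<in> P \<Longrightarrow> a \<bullet> x \<le> a \<bullet> z"
    using continuous_attains_sup[of P "\<lambda>x. a \<bullet> x"] p(1)
      continuous_on_inner[OF continuous_on_const continuous_on_id]
    by blast
  define F where "F = P \<inter> {x. a \<bullet> x = a \<bullet> z}"
  have F: "F face_of P"
    unfolding F_def using z conv by (intro face_of_Int_supporting_hyperplane_le) auto
  have bz: "b < a \<bullet> z" using z(2)[OF p(1)] p(2) by linarith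
  have "r \<notin> F" using bz p unfolding F_def by auto
  then have "F \<noteq> P" using p by blast
  have climb: "\<exists>m. {m} face_of F \<and> (u, m) \<in> (edge_rel P W)\<^sup>*"
    if u: "{u} face_of P" "u \<notin> W" "b \<le> a \<bullet> u" for u
  proof -
    \<comment> \<open>A highest vertex of the reachable set \<open>T\<close> must lie on
      \<open>F\<close>, because an increasing edge from it would lead to a higher vertex of
      \<open>T\<close>.\<close>
    define T where "T = {w. (u, w) \<in> (edge_rel P W)\<^sup>*}"
    have "T \<subseteq> {w. w extreme_point_of P}"
      using rtrancl_edge_rel_vertex(1) u unfolding T_def face_of_singleton by blast
    then have "finite T"
      using finite_polyhedron_extreme_points polytope_imp_polyhedron[OF P] finite_subset by blast
    moreover have "u \<in> T" unfolding T_def by simp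
    ultimately have "Max ((\<bullet>) a ` T) \<in> (\<bullet>) a ` T" and "\<And>w. w \<in> T \<Longrightarrow> a \<bullet> w \<le> Max ((\<bullet>) a ` T)"
      by (auto intro!: Max_in)
    then obtain m where m: "m \<in> T" "\<And>w. w \<in> T \<Longrightarrow> a \<bullet> w \<le> a \<bullet> m"
      by (metis imageE)
    have mv: "{m} face_of P" "m \<notin> W"
      using rtrancl_edge_rel_vertex m u unfolding T_def by blast+
    have "a \<bullet> m = a \<bullet> z"
    proof (rule ccontr)
      assume ne: "a \<bullet> m \<noteq> a \<bullet> z"
      have "m \<in> P" using mv face_of_imp_subset by blast
      then have "a \<bullet> m < a \<bullet> z" using z ne by force
      then obtain w where w: "closed_segment m w edge_of P" "a \<bullet> m < a \<bullet> w"
        using polytope_increasing_edge[OF P mv(1) z(1)] by blast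
      \<comment> \<open>The start may be at level \<open>b\<close> itself, but any vertex above
        \<open>m\<close> is strictly higher than \<open>b\<close>.\<close>
      have "b < a \<bullet> w"
        using w m \<open>u \<in> T\<close> u(3) by (meson dual_order.trans not_le)
      then have "w \<notin> W" using W by force
      then have "(m, w) \<in> edge_rel P W"
        unfolding edge_rel_def using w mv by blast
      then have "w \<in> T"
        using m(1) unfolding T_def by (metis mem_Collect_eq rtrancl.rtrancl_into_rtrancl)
      then show False using m(2) w(2) by force
    qed
    moreover have "m \<in> P" using mv face_of_imp_subset by blast
    ultimately have "m \<in> F" unfolding F_def by simp
    then have "{m} face_of F"
      using mv F by (simp add: face_of_face)
    then show ?thesis using m(1) unfolding T_def by blast
  qed
  obtain m where m: "{m} face_of F" "(u, m) \<in> (edge_rel P W)\<^sup>*"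
    using climb u by blast
  obtain n where n: "{n} face_of F" "(v, n) \<in> (edge_rel P W)\<^sup>*"
    using climb v by blast
  have "edge_rel F {} \<subseteq> edge_rel P W"
  proof -
    have "F \<inter> W = {}" using W bz unfolding F_def by force
    moreover have "u \<in> F" "v \<in> F" "closed_segment u v edge_of P"
      if "closed_segment u v edge_of F" for u v
      using that face_of_trans[OF _ F] edge_of_imp_subset[OF that] unfolding edge_of_def by auto
    ultimately show ?thesis
      unfolding edge_rel_def by blast
  qed
  then have "(m, n) \<in> (edge_rel P W)\<^sup>*"
    using faces[OF F \<open>F \<noteq> P\<close> m(1) n(1)] rtrancl_mono by blast
  then show ?thesis
    using m(2) rtrancl_edge_rel_sym[OF n(2)] by (meson rtrancl_trans)
qed

text \<open>Some point of \<open>P\<close> lies off the affine hull of \<open>S\<close>; that hull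
  is an intersection of hyperplanes, and one of them misses the point.\<close>

lemma nonconstant_functional_on_level:
  fixes P :: "'a::euclidean_space set"
  assumes "aff_dim S < aff_dim P"
  obtains a b where "\<And>s. s \<in> S \<Longrightarrow> a \<bullet> s = b" "\<exists>p\<in>P. a \<bullet> p \<noteq> b"
proof -
  obtain \<F> where F: "affine hull S = \<Inter>\<F>" "\<And>h. h \<in> \<F> \<Longrightarrow> \<exists>a b. a \<noteq> 0 \<and> h = {x. a \<bullet> x = b}"
    using affine_hull_finite_intersection_hyperplanes by metis
  have "\<not> P \<subseteq> affine hull S"
    using assms by (metis aff_dim_affine_hull aff_dim_subset not_le)
  then obtain h p where h: "h \<in> \<F>" "p \<in> P" "p \<notin> h"
    using F(1) by blast
  then obtain a b where ab: "h = {x. a \<bullet> x = b}" using F(2) by blast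
  have "S \<subseteq> h" using F(1) h(1) hull_subset[of S affine] by blast
  then show ?thesis using ab h that[of a b] by blast
qed

text \<open>Balinski's theorem; the alternative \<open>W = {}\<close> lets the induction reach all faces.\<close>
theorem polytope_graph_connected_diff:
  fixes P :: "'a::euclidean_space set"
  assumes "polytope P" "finite W" "W = {} \<or> int (card W) < aff_dim P"
    and "{x} face_of P" "x \<notin> W" "{y} face_of P" "y \<notin> W"
  shows "(x, y) \<in> (edge_rel P W)\<^sup>*"
  using assms
proof (induction "nat (aff_dim P)" arbitrary: P W x y rule: less_induct)
  case less
  have xP: "x \<in> P" "y \<in> P"
    using less.prems face_of_imp_subset by blast+
  have conv: "convex P" using less.prems(1) polytope_imp_convex by blast
  have "0 \<le> aff_dim P"
    using xP by (metis aff_dim_sing aff_dim_subset empty_subsetI insert_subset)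
  show ?case
  proof (cases "aff_dim P = 0")
    case True
    then have "x = y" using xP unfolding aff_dim_eq_0 by auto
    then show ?thesis by simp
  next
    case False
    then have dim: "0 < aff_dim P" using \<open>0 \<le> aff_dim P\<close> by linarith
    have faces: "(x, y) \<in> (edge_rel F {})\<^sup>*"
      if F: "F face_of P" "F \<noteq> P" "{x} face_of F" "{y} face_of F" for F x y
    proof -
      have "aff_dim F < aff_dim P"
        using F conv face_of_aff_dim_lt by blast
      then show ?thesis
        using F dim less.hyps[of F "{}" x y] face_of_polytope_polytope[OF less.prems(1)] by auto
    qed
    have "int (card W) < aff_dim P"
      using less.prems(3) dim by auto
    \<comment> \<open>A set of \<open>card W + 1\<close> points has dimension at most
      \<open>card W\<close>, so besides \<open>W\<close> the level hyperplane can also pass through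
      \<open>x\<close>. Thus \<open>x\<close> belongs to both closed halfspaces and may be joined to
      \<open>y\<close> on whichever side \<open>y\<close> lies.\<close>
    moreover have "aff_dim (insert x W) \<le> int (card W)"
      using aff_dim_le_card[of "insert x W"] less.prems(2,5) by (simp add: card_insert_if)
    ultimately obtain a b where ab: "\<And>s. s \<in> insert x W \<Longrightarrow> a \<bullet> s = b" "\<exists>p\<in>P. a \<bullet> p \<noteq> b"
      by (metis (no_types, lifting) le_less_trans nonconstant_functional_on_level)
    have up: "(x, y) \<in> (edge_rel P W)\<^sup>*"
      if c: "\<And>s. s \<in> insert x W \<Longrightarrow> c \<bullet> s = k" and p: "p \<in> P" "k < c \<bullet> p" and "k \<le> c \<bullet> y" for c k p
    proof (rule edge_rel_connects_halfspace[OF less.prems(1), of W c k p x])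
      show "c \<bullet> w \<le> k" if "w \<in> W" for w using c[of w] that by simp
      show "c \<bullet> x \<le> k" "k \<le> c \<bullet> x" using c[of x] by simp_all
    qed (use that less.prems faces xP in auto)
    obtain p where p: "p \<in> P" "a \<bullet> p \<noteq> b" using ab by blast
    have neg: "(- a) \<bullet> s = - b" if "s \<in> insert x W" for s
      using ab(1)[OF that] by simp
    \<comment> \<open>If \<open>y\<close> is also on the hyperplane, either side serves, provided it
      contains a point of \<open>P\<close> strictly inside; \<open>p\<close> selects one.\<close>
    consider "b < a \<bullet> y" | "a \<bullet> y < b" | "a \<bullet> y = b" "b < a \<bullet> p" | "a \<bullet> y = b" "a \<bullet> p < b"
      using p by linarith
    then show ?thesis
    proof cases
      case 1
      then show ?thesis using up[OF ab(1), of y] xP by simp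
    next
      case 2
      then show ?thesis using up[OF neg, of y] xP by simp
    next
      case 3
      then show ?thesis using up[OF ab(1), of p] p by simp
    next
      case 4
      then show ?thesis using up[OF neg, of p] p by simp
    qed
  qed
qed

section \<open>Cuts in graphs of simplicial polytopes\<close>

text \<open>The empty face, being least, goes to the empty face, so \<open>f {u}\<close> is nonempty
  and contains a vertex \<open>s\<close>. The preimage of \<open>{s}\<close> is a nonempty face
  inside \<open>{u}\<close>, hence \<open>{u}\<close> itself.\<close>

lemma simplex_isomorphism_vertex:
  fixes K :: "'a::euclidean_space set"
  assumes K: "\<not> affine_dependent K"
    and bij: "bij_betw f {A. A face_of F} {B. B face_of (convex hull K)}"
    and mono: "\<forall>A B. A face_of F \<longrightarrow> B face_of F \<longrightarrow> (A \<subseteq> B \<longleftrightarrow> f A \<subseteq> f B)"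
    and u: "{u} face_of F"
  shows "\<exists>s\<in>K. f {u} = {s}"
proof -
  have ord: "A \<subseteq> B \<longleftrightarrow> f A \<subseteq> f B" if "A face_of F" "B face_of F" for A B
    using mono that by blast
  note faces = face_of_convex_hull_affine_independent[OF K]
  have surj: "\<exists>A. A face_of F \<and> f A = B" if "B face_of (convex hull K)" for B
  proof -
    have "B \<in> f ` {A. A face_of F}"
      using bij_betw_imp_surj_on[OF bij] that by simp
    then show ?thesis by auto
  qed
  have inj: "A = B" if "A face_of F" "B face_of F" "f A = f B" for A B
    using ord[of A B] ord[of B A] that by auto
  obtain A0 where "A0 face_of F" "f A0 = {}"
    using surj[of "{}"] by auto
  then have f0: "f {} = {}" using ord[of "{}" A0] by auto
  have "f {u} face_of (convex hull K)"
    using bij_betwE[OF bij] u by simp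
  then obtain L where L: "L \<subseteq> K" "f {u} = convex hull L"
    using faces by blast
  have "f {u} \<noteq> {}"
    using inj[of "{u}" "{}"] u f0 by auto
  then obtain s where s: "s \<in> L" using L by fastforce
  then have "{s} face_of (convex hull K)"
    unfolding faces using L by (intro exI[of _ "{s}"]) auto
  then obtain A1 where A1: "A1 face_of F" "f A1 = {s}" using surj by blast
  have "{s} \<subseteq> f {u}" using s L by (simp add: hull_inc)
  then have "A1 \<subseteq> {u}" using ord[OF A1(1) u] A1(2) by simp
  moreover have "A1 \<noteq> {}" using A1 f0 by auto
  ultimately have "A1 = {u}" by blast
  then show ?thesis using A1 s L by blast
qed

text \<open>Any two vertices of a simplex span a face. The face \<open>G\<close> of \<open>F\<close>
  corresponding to that segment has no vertices besides \<open>u\<close> and \<open>w\<close>, so by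
  Krein-Milman it is the segment between them.\<close>

lemma simplex_like_polytope_edge:
  fixes F S :: "'a::euclidean_space set"
  assumes F: "polytope F" and S: "n simplex S" and iso: "combinatorially_isomorphic F S"
    and u: "{u} face_of F" and w: "{w} face_of F" and "u \<noteq> w"
  shows "closed_segment u w edge_of F"
proof -
  obtain K where K: "\<not> affine_dependent K" and SK: "S = convex hull K"
    using S unfolding simplex_def by blast
  obtain f where bij: "bij_betw f {A. A face_of F} {B. B face_of (convex hull K)}"
    and mono: "\<forall>A B. A face_of F \<longrightarrow> B face_of F \<longrightarrow> (A \<subseteq> B \<longleftrightarrow> f A \<subseteq> f B)"
    using iso unfolding combinatorially_isomorphic_def SK by blast
  have ord: "A \<subseteq> B \<longleftrightarrow> f A \<subseteq> f B" if "A face_of F" "B face_of F" for A B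
    using mono that by blast
  note vertex = simplex_isomorphism_vertex[OF K bij mono]
  obtain s where s: "s \<in> K" "f {u} = {s}" using vertex[OF u] by blast
  obtain t where t: "t \<in> K" "f {w} = {t}" using vertex[OF w] by blast
  have "convex hull {s, t} face_of (convex hull K)"
    unfolding face_of_convex_hull_affine_independent[OF K]
    using s t by (intro exI[of _ "{s, t}"]) simp
  then have "convex hull {s, t} \<in> f ` {A. A face_of F}"
    using bij_betw_imp_surj_on[OF bij] by simp
  then obtain G where G: "G face_of F" "f G = convex hull {s, t}" by auto
  have "{u} \<subseteq> G" "{w} \<subseteq> G"
    using ord[OF u G(1)] ord[OF w G(1)] s t G(2) by (simp_all add: hull_inc)
  have ext: "z = u \<or> z = w" if z: "z extreme_point_of G" for z
  proof -
    have zF: "{z} face_of F" and "z \<in> G"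
      using z extreme_point_of_face[OF G(1)] by (simp_all add: face_of_singleton)
    obtain r where r: "r \<in> K" "f {z} = {r}" using vertex[OF zF] by blast
    have "{r} \<subseteq> convex hull {s, t}"
      using ord[OF zF G(1)] \<open>z \<in> G\<close> r G(2) by simp
    moreover have "r extreme_point_of (convex hull K)"
      using r K by (simp add: extreme_point_of_convex_hull_affine_independent)
    ultimately have "r extreme_point_of (convex hull {s, t})"
      using extreme_point_of_face[OF \<open>convex hull {s, t} face_of (convex hull K)\<close>] by simp
    then have "r \<in> {s, t}" by (rule extreme_point_of_convex_hull)
    then have "f {z} = f {u} \<or> f {z} = f {w}" using r s t by auto
    then show ?thesis
      using ord[OF zF u] ord[OF zF w] by auto
  qed
  have "compact G" "convex G"
    using G F face_of_polytope_polytope polytope_imp_compact polytope_imp_convex by blast+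
  then have "G = convex hull {z. z extreme_point_of G}"
    by (rule Krein_Milman_Minkowski)
  also have "\<dots> \<subseteq> convex hull {u, w}"
    using ext by (intro hull_mono) blast
  finally have "G \<subseteq> closed_segment u w" by (simp add: segment_convex_hull)
  moreover have "closed_segment u w \<subseteq> G"
    using \<open>{u} \<subseteq> G\<close> \<open>{w} \<subseteq> G\<close> \<open>convex G\<close> by (simp add: closed_segment_subset)
  ultimately have "G = closed_segment u w" by blast
  moreover have "aff_dim (closed_segment u w) = 1"
    using \<open>u \<noteq> w\<close> by (simp add: segment_convex_hull aff_dim_convex_hull aff_dim_2)
  ultimately show ?thesis
    using G(1) unfolding edge_of_def by simp
qed

lemma polytope_vertices:
  fixes F :: "'a::euclidean_space set"
  assumes "polytope F"
  shows "finite {v. {v} face_of F}" "F = convex hull {v. {v} face_of F}"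
    "aff_dim F < int (card {v. {v} face_of F})"
proof -
  show fin: "finite {v. {v} face_of F}"
    using finite_polyhedron_extreme_points[OF polytope_imp_polyhedron[OF assms]]
    by (simp only: face_of_singleton)
  show F: "F = convex hull {v. {v} face_of F}"
    unfolding face_of_singleton
    using Krein_Milman_Minkowski assms polytope_imp_compact polytope_imp_convex by blast
  show "aff_dim F < int (card {v. {v} face_of F})"
    using aff_dim_le_card[OF fin] by (subst F) (simp add: aff_dim_convex_hull)
qed

lemma simplicial_polytope_facet_edge:
  assumes "simplicial_polytope P" "F facet_of P" "{u} face_of F" "{w} face_of F" "u \<noteq> w"
  shows "closed_segment u w edge_of P"
proof -
  have "F face_of P" "polytope F"
    using assms(1,2) facet_of_imp_face_of face_of_polytope_polytope
    unfolding simplicial_polytope_def by blast+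
  then have "closed_segment u w edge_of F"
    using assms simplex_like_polytope_edge unfolding simplicial_polytope_def by blast
  then show ?thesis
    using \<open>F face_of P\<close> face_of_trans unfolding edge_of_def by blast
qed

text \<open>The edge lies in two facets \<open>F\<close> and \<open>F'\<close>, in each of which all
  vertices are pairwise adjacent. \<open>F\<close> has at least \<open>d\<close> vertices,
  \<open>d\<close> being the dimension of \<open>P\<close>, which leaves \<open>d - 2\<close> common
  neighbours; a vertex of \<open>F'\<close> outside \<open>F\<close> is one more.\<close>

lemma simplicial_polytope_common_neighbours:
  fixes P :: "'a::euclidean_space set"
  assumes P: "simplicial_polytope P" and dim: "3 \<le> aff_dim P"
    and e: "closed_segment x y edge_of P"
  obtains N where "finite N" "aff_dim P \<le> int (card N) + 1" "x \<notin> N" "y \<notin> N"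
    "\<And>z. z \<in> N \<Longrightarrow> closed_segment x z edge_of P \<and> closed_segment y z edge_of P"
proof -
  have poly: "polytope P" using P unfolding simplicial_polytope_def by blast
  have xy: "closed_segment x y face_of P" "aff_dim (closed_segment x y) = 1"
    using e unfolding edge_of_def by auto
  have "closed_segment x y \<noteq> P" using xy dim by auto
  then have Inter: "closed_segment x y = \<Inter>{F. F facet_of P \<and> closed_segment x y \<subseteq> F}"
    using face_of_polyhedron[OF polytope_imp_polyhedron[OF poly] xy(1)] by auto
  obtain F where F: "F facet_of P" "closed_segment x y \<subseteq> F"
    using face_of_polyhedron_subset_facet[OF polytope_imp_polyhedron[OF poly] xy(1)]
      \<open>closed_segment x y \<noteq> P\<close> by auto
  have dimF: "aff_dim F = aff_dim P - 1" using F unfolding facet_of_def by blast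
  then have "F \<noteq> closed_segment x y" using xy dim by auto
  \<comment> \<open>The edge is the intersection of the facets containing it, and \<open>F\<close>
    is strictly larger than the edge, so some such facet does not contain \<open>F\<close>.\<close>
  then obtain F' where F': "F' facet_of P" "closed_segment x y \<subseteq> F'" "\<not> F \<subseteq> F'"
    using Inter F(2) by blast
  have polyF: "polytope F" "polytope F'"
    using F(1) F'(1) facet_of_imp_face_of face_of_polytope_polytope poly by blast+
  have "\<not> F' \<subseteq> F"
  proof
    assume "F' \<subseteq> F"
    then have "F' face_of F"
      using F F' facet_of_imp_face_of face_of_face by metis
    moreover have "aff_dim F' = aff_dim F"
      using F' dimF unfolding facet_of_def by simp
    ultimately have "F' = F"
      using face_of_aff_dim_lt polyF polytope_imp_convex by (metis less_irrefl)
    then show False using F' by blast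
  qed
  moreover have "F' \<subseteq> F" if "{v. {v} face_of F'} \<subseteq> F"
    using polytope_vertices(2)[OF polyF(2)] hull_minimal[of _ F convex] that polyF(1) polytope_imp_convex
    by metis
  ultimately obtain z' where z': "{z'} face_of F'" "z' \<notin> F" by blast
  have ends: "{x} face_of F" "{y} face_of F" "{x} face_of F'" "{y} face_of F'"
  proof -
    have "{y} face_of P" "{x} face_of P"
      using edge_of_imp_vertex e closed_segment_commute by metis+
    then show "{x} face_of F" "{y} face_of F" "{x} face_of F'" "{y} face_of F'"
      using F F' facet_of_imp_face_of[of F P] facet_of_imp_face_of[of F' P]
      by (auto simp: face_of_face)
  qed
  define V where "V = {v. {v} face_of F}"
  have V: "finite V" "aff_dim P \<le> int (card V)"
    using polytope_vertices(1,3)[OF polyF(1)] dimF unfolding V_def by auto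
  have xF: "x \<in> F" "y \<in> F" using F(2) by auto
  define N where "N = insert z' (V - {x, y})"
  show ?thesis
  proof (rule that)
    show "finite N" using V unfolding N_def by simp
    have "z' \<notin> V" using z'(2) face_of_imp_subset unfolding V_def by blast
    moreover have "x \<noteq> y" using xy(2) by auto
    then have "card (V - {x, y}) + 2 \<ge> card V"
      using card_Diff_subset[of "{x, y}" V] ends V(1) unfolding V_def by simp
    ultimately have "card N + 1 \<ge> card V"
      using V(1) unfolding N_def by simp
    then show "aff_dim P \<le> int (card N) + 1"
      using V(2) by linarith
    show "x \<notin> N" "y \<notin> N" using z' xF unfolding N_def by auto
    fix z assume z: "z \<in> N"
    then have "z \<noteq> x" "z \<noteq> y" using z' xF unfolding N_def by auto
    then show "closed_segment x z edge_of P \<and> closed_segment y z edge_of P"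
      using z z'(1) ends simplicial_polytope_facet_edge[OF P F(1)]
        simplicial_polytope_facet_edge[OF P F'(1)]
      unfolding N_def V_def by auto
  qed
qed

section \<open>Covers and triangles of a cut\<close>

lemma polytope_graph_edge_iff: "{u, v} \<in> gedges (polytope_graph P) \<longleftrightarrow> closed_segment u v edge_of P"
  unfolding polytope_graph_def by (auto simp: doubleton_eq_iff closed_segment_commute)

lemma rtrancl_leaves_set:
  assumes "(x, y) \<in> R\<^sup>*" "x \<in> X" "y \<notin> X"
  shows "\<exists>u v. (u, v) \<in> R \<and> u \<in> X \<and> v \<notin> X"
  using assms by (induction) blast+

text \<open>Deleting a cover destroys every cut edge and so disconnects \<open>x\<close> from
  \<open>y\<close>, which by Balinski's theorem takes at least \<open>aff_dim P\<close>
  vertices.\<close>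

lemma polytope_cut_covers_large:
  assumes P: "polytope P" and X: "X \<subseteq> gverts (polytope_graph P)"
    and x: "x \<in> X" "x \<notin> Domain (cut_pairs (polytope_graph P) X)"
    and y: "y \<in> gverts (polytope_graph P) - X" "y \<notin> Range (cut_pairs (polytope_graph P) X)"
    and cov: "covers (cut_pairs (polytope_graph P) X) S T"
  shows "aff_dim P \<le> int (card S + card T)"
proof (rule ccontr)
  assume less: "\<not> ?thesis"
  \<comment> \<open>Balinski's theorem needs \<open>x\<close> and \<open>y\<close> undeleted.
    Sparing them is harmless, since neither is an end of a cut edge.\<close>
  define W where "W = (S \<union> T) - {x, y}"
  have fin: "finite S" "finite T" using cov unfolding covers_def by auto
  have "card W \<le> card (S \<union> T)"
    unfolding W_def using fin by (intro card_mono) auto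
  also have "\<dots> \<le> card S + card T" by (rule card_Un_le)
  finally have "int (card W) < aff_dim P" using less by linarith
  moreover have "{x} face_of P" "{y} face_of P"
    using x y X unfolding polytope_graph_def by auto
  ultimately have "(x, y) \<in> (edge_rel P W)\<^sup>*"
    using P fin by (intro polytope_graph_connected_diff) (auto simp: W_def)
  then obtain u v where uv: "(u, v) \<in> edge_rel P W" "u \<in> X" "v \<notin> X"
    using rtrancl_leaves_set[of x y _ X] x(1) y(1) by blast
  then have e: "closed_segment u v edge_of P" and W: "u \<notin> W" "v \<notin> W"
    unfolding edge_rel_def by auto
  have "v \<in> gverts (polytope_graph P)"
    using edge_of_imp_vertex[OF e] by (simp add: polytope_graph_def)
  then have cut: "(u, v) \<in> cut_pairs (polytope_graph P) X"
    using uv e unfolding cut_pairs_def by (simp add: polytope_graph_edge_iff)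
  then have "u \<noteq> x" "v \<noteq> y" using x(2) y(2) by blast+
  moreover have "u \<in> S \<or> v \<in> T" using cov cut unfolding covers_def by blast
  ultimately show False
    using W uv x(1) y(1) unfolding W_def by blast
qed

text \<open>A triangle on the cut edge \<open>(u, v)\<close> with third vertex \<open>z\<close>
  contains one more cut edge: \<open>(z, v)\<close> if \<open>z\<close> is in \<open>X\<close>, and
  \<open>(u, z)\<close> otherwise. Different \<open>z\<close> give different edges.\<close>

lemma simplicial_polytope_cut_neighbours:
  fixes P :: "'a::euclidean_space set"
  assumes P: "simplicial_polytope P" and dim: "3 \<le> aff_dim P"
    and X: "X \<subseteq> gverts (polytope_graph P)" and e: "e \<in> cut_pairs (polytope_graph P) X"
  shows "aff_dim P \<le> int (card {f \<in> cut_pairs (polytope_graph P) X.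
                              f \<noteq> e \<and> (fst f = fst e \<or> snd f = snd e)}) + 1"
proof -
  let ?C = "cut_pairs (polytope_graph P) X"
  obtain u v where uv: "e = (u, v)" by fastforce
  have u: "u \<in> X" "v \<notin> X" "closed_segment u v edge_of P"
    using e unfolding uv cut_pairs_def by (auto simp: polytope_graph_edge_iff)
  obtain N where N: "finite N" "aff_dim P \<le> int (card N) + 1" "u \<notin> N" "v \<notin> N"
    "\<And>z. z \<in> N \<Longrightarrow> closed_segment u z edge_of P \<and> closed_segment v z edge_of P"
    using simplicial_polytope_common_neighbours[OF P dim u(3)] by blast
  have "finite ?C"
    using P X finite_cut_pairs finite_simple_polytope_graph unfolding simplicial_polytope_def by blast
  have "card N \<le> card {f \<in> ?C. f \<noteq> e \<and> (fst f = fst e \<or> snd f = snd e)}"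
  proof (rule card_inj_on_le)
    let ?f = "\<lambda>z. if z \<in> X then (z, v) else (u, z)"
    show "inj_on ?f N"
      using N(3,4) by (auto simp: inj_on_def split: if_splits)
    show "finite {f \<in> ?C. f \<noteq> e \<and> (fst f = fst e \<or> snd f = snd e)}"
      using \<open>finite ?C\<close> by simp
    show "?f ` N \<subseteq> {f \<in> ?C. f \<noteq> e \<and> (fst f = fst e \<or> snd f = snd e)}"
    proof
      fix f assume "f \<in> ?f ` N"
      then obtain z where z: "z \<in> N" "f = ?f z" by blast
      have zv: "z \<noteq> u" "z \<noteq> v" using z N by auto
      have "{z} face_of P" "{v} face_of P"
        using N(5)[OF z(1)] u(3) edge_of_imp_vertex by blast+
      moreover have "closed_segment z v edge_of P" "closed_segment u z edge_of P"
        using N(5)[OF z(1)] by (simp_all add: closed_segment_commute)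
      ultimately show "f \<in> {f \<in> ?C. f \<noteq> e \<and> (fst f = fst e \<or> snd f = snd e)}"
        using z(2) u zv unfolding uv cut_pairs_def
        by (auto simp: polytope_graph_edge_iff) (auto simp: polytope_graph_def)
    qed
  qed
  then show ?thesis using N(2) by linarith
qed

section \<open>The lower bound on the size of a cut\<close>

theorem corollary10:
  fixes P :: "'a::euclidean_space set" and d \<delta> :: nat
  assumes "d \<ge> 3"
    and "simplicial_polytope P"
    and "aff_dim P = int d"
    and "min_degree (polytope_graph P) = \<delta>"
  shows "edge_connected (min \<delta> (4 * d - 6)) (polytope_graph P)"
  unfolding edge_connected_def
proof (intro ballI impI notI, elim exE conjE)
  fix x y Z
  let ?G = "polytope_graph P"
  assume x: "x \<in> gverts ?G" and y: "y \<in> gverts ?G" and "x \<noteq> y"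
    and Z: "Z \<subseteq> gedges ?G" "finite Z" "card Z < min \<delta> (4 * d - 6)" "edge_separates ?G Z x y"
  have poly: "polytope P" using assms(2) unfolding simplicial_polytope_def by blast
  have G: "finite_simple_graph ?G" by (rule finite_simple_polytope_graph[OF poly])
  \<comment> \<open>The vertices reachable from \<open>x\<close> while avoiding \<open>Z\<close>, so
    that every edge leaving \<open>X\<close> belongs to \<open>Z\<close>.\<close>
  define X where "X = {u. (x, u) \<in> {(u, v). {u, v} \<in> gedges ?G - Z}\<^sup>*}"
  define C where "C = cut_pairs ?G X"
  have "x \<in> X" unfolding X_def by simp
  have "y \<notin> X"
    using rtrancl_imp_path[OF G x] Z(4) unfolding X_def edge_separates_def by blast
  have XG: "X \<subseteq> gverts ?G"
  proof
    fix u assume "u \<in> X"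
    then have "(x, u) \<in> {(u, v). {u, v} \<in> gedges ?G - Z}\<^sup>*" unfolding X_def by simp
    then show "u \<in> gverts ?G"
      by (cases rule: rtranclE) (use x G in \<open>auto simp: finite_simple_graph_def\<close>)
  qed
  have "card C \<le> card Z"
  proof (rule card_inj_on_le[OF _ _ Z(2)])
    show "inj_on (\<lambda>(u, v). {u, v}) C"
      unfolding C_def cut_pairs_def by (auto simp: inj_on_def doubleton_eq_iff)
    show "(\<lambda>(u, v). {u, v}) ` C \<subseteq> Z"
    proof clarify
      fix u v assume uv: "(u, v) \<in> C"
      show "{u, v} \<in> Z"
      proof (rule ccontr)
        assume "{u, v} \<notin> Z"
        then have "(u, v) \<in> {(u, v). {u, v} \<in> gedges ?G - Z}"
          using uv unfolding C_def cut_pairs_def by auto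
        moreover have "u \<in> X" "v \<notin> X" using uv unfolding C_def cut_pairs_def by auto
        ultimately show False
          unfolding X_def by (metis (no_types, lifting) mem_Collect_eq rtrancl.rtrancl_into_rtrancl)
      qed
    qed
  qed
  then have small: "card C < \<delta>" "card C < 4 * d - 6" using Z(3) by auto
  have degree: "\<delta> \<le> vdegree ?G u" if "u \<in> gverts ?G" for u
    using assms(4) G that unfolding min_degree_def finite_simple_graph_def by auto
  obtain x0 where x0: "x0 \<in> X" "x0 \<notin> Domain C"
    using vdegree_le_card_cut_pairs[OF G XG \<open>x \<in> X\<close>] degree[OF x] small(1)
    unfolding C_def by fastforce
  \<comment> \<open>The same count for the other side, whose cut is the converse of
    \<open>C\<close>.\<close>
  obtain y0 where y0: "y0 \<in> gverts ?G - X" "y0 \<notin> Range C"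
    using vdegree_le_card_cut_pairs[OF G, of "gverts ?G - X" y] degree[OF y] small(1) y \<open>y \<notin> X\<close>
    unfolding C_def cut_pairs_complement[OF XG] Domain_converse card_inverse by fastforce
  have "finite C" unfolding C_def by (rule finite_cut_pairs[OF G XG])
  have "d \<le> card S + card T" if "covers C S T" for S T
    using polytope_cut_covers_large[OF poly XG x0(1) _ y0(1)] x0(2) y0(2) that assms(3)
    unfolding C_def by fastforce
  then obtain M where M: "M \<subseteq> C" "inj_on fst M" "inj_on snd M" "card M = d"
    using matching_of_large_covers[OF \<open>finite C\<close>] by metis
  have "d - 1 \<le> card {f \<in> C. f \<noteq> e \<and> (fst f = fst e \<or> snd f = snd e)}" if "e \<in> M" for e
    using simplicial_polytope_cut_neighbours[OF assms(2) _ XG] assms(1,3) M(1) that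
    unfolding C_def by fastforce
  then have "d * (d - 1) \<le> 2 * (card C - d)"
    using matching_double_count[OF \<open>finite C\<close> M(1-3), of "d - 1"] M(4) by simp
  \<comment> \<open>What remains is \<open>(d - 3) * (d - 4) \<ge> 0\<close>, that is
    \<open>k * k \<ge> k\<close>; it follows from \<open>(k - 1)^2 \<ge> 0\<close>, written without
    subtraction below.\<close>
  moreover obtain k where "d = k + 3"
    using assms(1) by (metis add.commute le_Suc_ex)
  moreover have "2 * k \<le> k * k + 1"
    by (cases k) auto
  ultimately show False using small(2) by (auto simp: algebra_simps)
qed

end
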